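(* A pseudocompact Tychonoff space $X$ is a $Q_f$-space if, and only if, $X$ is a countable metrizable compact space.
   Context: A space is pseudocompact if every continuous real-valued function on it is bounded. A subset $A\subseteq X$ is a zero-set if $A=f^{-1}(0)$ for some continuous $f:X\to\mathbb{R}$; a cozero-set is the complement of a zero-set. A $Zer_\sigma$-set is a countable union of zero-sets, a $Coz_\delta$-set is a countable intersection of cozero-sets, and a $CZ$-set is a set which is both a $Zer_\sigma$-set and a $Coz_\delta$-set. $X$ is a $Q_f$-space if each subset of $X$ is a $CZ$-set. *)

theory Defs
  imports "HOL-Analysis.Analysis"
begin

definition tychonoff_space :: "'a topology \<Rightarrow> bool" where
  "tychonoff_space X \<longleftrightarrow> completely_regular_space X \<and> t1_space X"

definition pseudocompact_space :: "'a topology \<Rightarrow> bool" where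
  "pseudocompact_space X \<longleftrightarrow>
     (\<forall>f :: 'a \<Rightarrow> real. continuous_map X euclideanreal f \<longrightarrow> bounded (f ` topspace X))"

definition zero_set_in :: "'a topology \<Rightarrow> 'a set \<Rightarrow> bool" where
  "zero_set_in X A \<longleftrightarrow>
     (\<exists>f :: 'a \<Rightarrow> real. continuous_map X euclideanreal f \<and> A = {x \<in> topspace X. f x = 0})"

definition cozero_set_in :: "'a topology \<Rightarrow> 'a set \<Rightarrow> bool" where
  "cozero_set_in X A \<longleftrightarrow> (\<exists>Z. zero_set_in X Z \<and> A = topspace X - Z)"

(* Countable families are indexed by nat. Repetition covers finite families; the empty family
   adds nothing, as the empty set and topspace X are both zero-sets and cozero-sets. *)

definition Zer_sigma_in :: "'a topology \<Rightarrow> 'a set \<Rightarrow> bool" where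
  "Zer_sigma_in X A \<longleftrightarrow>
     (\<exists>Z :: nat \<Rightarrow> 'a set. (\<forall>n. zero_set_in X (Z n)) \<and> A = (\<Union>n. Z n))"

definition Coz_delta_in :: "'a topology \<Rightarrow> 'a set \<Rightarrow> bool" where
  "Coz_delta_in X A \<longleftrightarrow>
     (\<exists>U :: nat \<Rightarrow> 'a set. (\<forall>n. cozero_set_in X (U n)) \<and> A = (\<Inter>n. U n))"

definition CZ_set_in :: "'a topology \<Rightarrow> 'a set \<Rightarrow> bool" where
  "CZ_set_in X A \<longleftrightarrow> Zer_sigma_in X A \<and> Coz_delta_in X A"

definition Qf_space :: "'a topology \<Rightarrow> bool" where
  "Qf_space X \<longleftrightarrow> (\<forall>A. A \<subseteq> topspace X \<longrightarrow> CZ_set_in X A)"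

end

theory Submission
  imports Defs
begin

text \<open>In a pseudocompact space a decreasing sequence of nonempty zero-sets has nonempty
  intersection: otherwise a weighted sum of the defining functions would be positive with
  unbounded inverse. Let \<open>X\<close> be a pseudocompact \<open>Q\<^sub>f\<close>-space and suppose it is uncountable. Every
  uncountable zero-set \<open>Z\<close> splits into two uncountable pieces; writing each piece as a countable
  union of zero-sets yields two disjoint uncountable zero-sets inside \<open>Z\<close>. This gives a Cantor
  tree of zero-sets all of whose branches have nonempty intersection, and the union of the
  branches that are eventually constant with value true cannot be both \<open>Zer\<^sub>\<sigma>\<close> and \<open>Coz\<^sub>\<delta>\<close>, by the
  usual Baire category argument. Hence \<open>X\<close> is countable, the intersection property makes it compact,
  and since singletons are zero-sets it embeds into a countable power of the real line.\<close>

section \<open>Zero-sets\<close>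

lemma zero_set_in_subset: "zero_set_in X Z \<Longrightarrow> Z \<subseteq> topspace X"
  by (auto simp: zero_set_in_def)

lemma zero_set_in_empty: "zero_set_in X {}"
  unfolding zero_set_in_def by (rule exI[of _ "\<lambda>_. 1"]) auto

lemma zero_set_in_topspace: "zero_set_in X (topspace X)"
  unfolding zero_set_in_def by (rule exI[of _ "\<lambda>_. 0"]) auto

lemma zero_set_in_Int:
  assumes "zero_set_in X Y" "zero_set_in X Z"
  shows "zero_set_in X (Y \<inter> Z)"
proof -
  obtain f g where f: "continuous_map X euclideanreal f" "Y = {x \<in> topspace X. f x = 0}"
    and g: "continuous_map X euclideanreal g" "Z = {x \<in> topspace X. g x = 0}"
    using assms unfolding zero_set_in_def by auto
  have "continuous_map X euclideanreal (\<lambda>x. \<bar>f x\<bar> + \<bar>g x\<bar>)"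
    using f g by (intro continuous_intros) auto
  moreover have "Y \<inter> Z = {x \<in> topspace X. \<bar>f x\<bar> + \<bar>g x\<bar> = 0}"
    using f g by auto
  ultimately show ?thesis
    unfolding zero_set_in_def by blast
qed

lemma zero_set_in_INT_finite:
  assumes "finite I" "\<And>i. i \<in> I \<Longrightarrow> zero_set_in X (Z i)"
  shows "zero_set_in X (topspace X \<inter> (\<Inter>i\<in>I. Z i))"
  using assms
proof (induction I rule: finite_induct)
  case empty
  then show ?case by (simp add: zero_set_in_topspace)
next
  case (insert i I)
  have "topspace X \<inter> (\<Inter>i\<in>insert i I. Z i) = Z i \<inter> (topspace X \<inter> (\<Inter>i\<in>I. Z i))"
    by auto
  then show ?case using insert by (simp add: zero_set_in_Int)
qed

text \<open>Cutting the absolute value off at 1 keeps the zeros; the bounds make geometrically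
  weighted series of such functions converge.\<close>

lemma zero_set_in_unit_function:
  assumes "zero_set_in X Z"
  obtains f :: "'a \<Rightarrow> real" where "continuous_map X euclideanreal f"
    "Z = {x \<in> topspace X. f x = 0}" "\<And>x. 0 \<le> f x" "\<And>x. f x \<le> 1"
proof -
  obtain f where f: "continuous_map X euclideanreal f" "Z = {x \<in> topspace X. f x = 0}"
    using assms unfolding zero_set_in_def by auto
  show ?thesis
  proof
    show "continuous_map X euclideanreal (\<lambda>x. min 1 \<bar>f x\<bar>)"
      using f by (intro continuous_intros) auto
    show "Z = {x \<in> topspace X. min 1 \<bar>f x\<bar> = 0}"
      using f by (auto simp: min_def)
  qed auto
qed

lemma Coz_delta_in_iff:
  "Coz_delta_in X A \<longleftrightarrow> A \<subseteq> topspace X \<and> Zer_sigma_in X (topspace X - A)"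
proof
  assume "Coz_delta_in X A"
  then obtain U where "\<forall>n::nat. \<exists>Z. zero_set_in X Z \<and> U n = topspace X - Z" "A = (\<Inter>n. U n)"
    unfolding Coz_delta_in_def cozero_set_in_def by auto
  then obtain Z where Z: "\<And>n::nat. zero_set_in X (Z n)" "\<And>n. U n = topspace X - Z n"
    by metis
  then have "topspace X - A = (\<Union>n. Z n)"
    using \<open>A = (\<Inter>n. U n)\<close> zero_set_in_subset[OF Z(1)] by fastforce
  then show "A \<subseteq> topspace X \<and> Zer_sigma_in X (topspace X - A)"
    unfolding Zer_sigma_in_def using Z \<open>A = (\<Inter>n. U n)\<close> by auto
next
  assume A: "A \<subseteq> topspace X \<and> Zer_sigma_in X (topspace X - A)"
  then obtain Z where Z: "\<And>n::nat. zero_set_in X (Z n)" "topspace X - A = (\<Union>n. Z n)"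
    unfolding Zer_sigma_in_def by auto
  then have "A = (\<Inter>n. topspace X - Z n)"
    using A by blast
  then show "Coz_delta_in X A"
    unfolding Coz_delta_in_def cozero_set_in_def using Z(1)
    by (intro exI[of _ "\<lambda>n. topspace X - Z n"]) auto
qed

text \<open>Complementation permutes the subsets of the space and exchanges the two halves of
  \<open>CZ_set_in\<close>, so one half for all subsets gives the other.\<close>

lemma Qf_space_iff: "Qf_space X \<longleftrightarrow> (\<forall>A. A \<subseteq> topspace X \<longrightarrow> Zer_sigma_in X A)"
  unfolding Qf_space_def CZ_set_in_def Coz_delta_in_iff by auto

section \<open>Countable intersections in pseudocompact spaces\<close>

text \<open>By the Weierstrass M-test the partial sums converge uniformly. \<open>Met_TC\<close>
  presents the target as an abstract metric space, where uniform limits of continuous maps are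
  continuous.\<close>

lemma continuous_map_suminf:
  fixes f :: "nat \<Rightarrow> 'a \<Rightarrow> 'b::banach"
  assumes "\<And>n. continuous_map X euclidean (f n)" "summable M"
    and "\<And>n x. x \<in> topspace X \<Longrightarrow> norm (f n x) \<le> M n"
  shows "continuous_map X euclidean (\<lambda>x. \<Sum>n. f n x)"
proof -
  have "uniform_limit (topspace X) (\<lambda>n x. \<Sum>i<n. f i x) (\<lambda>x. \<Sum>n. f n x) sequentially"
    using assms by (intro Weierstrass_m_test) auto
  then have "continuous_map X Met_TC.mtopology (\<lambda>x. \<Sum>n. f n x)"
    using assms(1)
    by (intro Met_TC.continuous_map_uniform_limit
          [where F = sequentially and f = "\<lambda>n x. \<Sum>i<n. f i x"])
       (auto simp: uniform_limit_iff intro!: always_eventually continuous_map_sum)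
  then show ?thesis by simp
qed

lemma pseudocompact_decseq_zero_sets:
  fixes Z :: "nat \<Rightarrow> 'a set"
  assumes pc: "pseudocompact_space X" and Z: "\<And>n. zero_set_in X (Z n)"
    and dec: "decseq Z" and ne: "\<And>n. Z n \<noteq> {}"
  shows "(\<Inter>n. Z n) \<noteq> {}"
proof
  assume empty: "(\<Inter>n. Z n) = {}"
  have "\<exists>f :: 'a \<Rightarrow> real. continuous_map X euclideanreal f \<and> Z n = {x \<in> topspace X. f x = 0}
      \<and> (\<forall>x. 0 \<le> f x \<and> f x \<le> 1)" for n
    by (rule zero_set_in_unit_function[OF Z[of n]]) blast
  then obtain f :: "nat \<Rightarrow> 'a \<Rightarrow> real" where f: "\<And>n. continuous_map X euclideanreal (f n)"
    "\<And>n. Z n = {x \<in> topspace X. f n x = 0}" "\<And>n x. 0 \<le> f n x" "\<And>n x. f n x \<le> 1"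
    by metis
  \<comment> \<open>If no point lies in every \<open>Z n\<close>, some term is positive at each
    point, so \<open>h\<close> is positive and has a continuous inverse.\<close>
  define h where "h x = (\<Sum>n. (1/2)^n * f n x)" for x
  have sm: "summable (\<lambda>n. (1/2)^n :: real)" by (simp add: summable_geometric)
  have smf: "summable (\<lambda>n. (1/2)^n * f n x)" for x
    using f(3,4) by (intro summable_comparison_test'[OF sm, of 0]) (auto simp: mult_left_le)
  have "continuous_map X euclideanreal h"
    unfolding h_def using f
    by (intro continuous_map_suminf[OF _ sm] continuous_map_real_mult_left)
       (auto simp: mult_left_le)
  moreover have pos: "h x > 0" if "x \<in> topspace X" for x
  proof -
    obtain n where "x \<notin> Z n" using empty by blast
    then have "f n x > 0" using f(2,3)[of n] that by (metis (mono_tags, lifting) mem_Collect_eq order_le_less)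
    then show ?thesis
      unfolding h_def using f(3) by (intro suminf_pos2[OF smf, of _ n]) auto
  qed
  ultimately have "continuous_map X euclideanreal (\<lambda>x. inverse (h x))"
    by (intro continuous_map_real_inverse) force+
  then have "bounded ((\<lambda>x. inverse (h x)) ` topspace X)"
    using pc unfolding pseudocompact_space_def by blast
  then obtain B where B: "\<And>x. x \<in> topspace X \<Longrightarrow> \<bar>inverse (h x)\<bar> \<le> B"
    unfolding bounded_iff by auto
  obtain N where N: "B < 2^N"
    using real_arch_pow[of 2 B] by auto
  \<comment> \<open>A point of \<open>Z (Suc N)\<close> kills the terms 0 to \<open>N\<close>; the
    remaining tail is at most \<open>2 * (1/2)^Suc N\<close>, so the inverse of \<open>h\<close>
    reaches \<open>2^N\<close> there and exceeds its bound \<open>B\<close>.\<close>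
  obtain x where x: "x \<in> Z (Suc N)" using ne by blast
  then have xX: "x \<in> topspace X" using f(2) by auto
  have zero: "f n x = 0" if "n < Suc N" for n
  proof -
    have "x \<in> Z n" using x decseqD[OF dec, of n "Suc N"] that by auto
    then show ?thesis using f(2) by auto
  qed
  have "h x = (\<Sum>n. (1/2)^(n + Suc N) * f (n + Suc N) x)"
    unfolding h_def using suminf_split_initial_segment[OF smf[of x], of "Suc N"] zero by simp
  also have "\<dots> \<le> (\<Sum>n. (1/2)^Suc N * (1/2)^n)"
    using f(3,4) sm
    by (intro suminf_le summable_ignore_initial_segment[OF smf[of x]] summable_mult)
       (auto simp: power_add mult_left_le)
  also have "\<dots> = (1/2)^Suc N * 2"
    using suminf_mult[OF sm, of "(1/2)^Suc N"] suminf_geometric[of "1/2::real"] by simp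
  finally have "h x \<le> inverse (2^N)"
    by (simp add: power_one_over inverse_eq_divide)
  then have "2^N \<le> inverse (h x)"
    using pos[OF xX] by (metis inverse_inverse_eq le_imp_inverse_le)
  then show False using B[OF xX] N by linarith
qed

text \<open>The finite partial intersections form a decreasing sequence of zero-sets, so they cannot
  all be nonempty.\<close>

lemma pseudocompact_countable_zero_sets:
  assumes pc: "pseudocompact_space X" and Z: "\<And>n::nat. zero_set_in X (Z n)"
    and empty: "(\<Inter>n. Z n) = {}"
  obtains n where "topspace X \<inter> (\<Inter>i\<le>n. Z i) = {}"
proof -
  have "\<exists>n. topspace X \<inter> (\<Inter>i\<le>n. Z i) = {}"
  proof (rule ccontr)
    assume "\<not> ?thesis"
    then have "(\<Inter>n. topspace X \<inter> (\<Inter>i\<le>n. Z i)) \<noteq> {}"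
      using Z by (intro pseudocompact_decseq_zero_sets[OF pc])
        (auto simp: decseq_def intro!: zero_set_in_INT_finite)
    then show False using empty by blast
  qed
  then show ?thesis using that by blast
qed

section \<open>Countability\<close>

text \<open>The tree argument needs only a nonempty family of nonempty zero-sets in which every
  member contains two disjoint members; cardinality enters later, when this is applied to the
  uncountable zero-sets.\<close>

lemma no_splitting_zero_sets_if_Qf:
  assumes pc: "pseudocompact_space X" and Qf: "Qf_space X"
    and "\<Z> \<noteq> {}" and zero: "\<And>Z. Z \<in> \<Z> \<Longrightarrow> zero_set_in X Z" and ne: "{} \<notin> \<Z>"
    and split: "\<And>Z. Z \<in> \<Z> \<Longrightarrow> \<exists>Y\<in>\<Z>. \<exists>Y'\<in>\<Z>. Y \<subseteq> Z \<and> Y' \<subseteq> Z \<and> Y \<inter> Y' = {}"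
  shows False
proof -
  obtain l r where l: "\<And>Z. Z \<in> \<Z> \<Longrightarrow> l Z \<in> \<Z> \<and> l Z \<subseteq> Z"
    and r: "\<And>Z. Z \<in> \<Z> \<Longrightarrow> r Z \<in> \<Z> \<and> r Z \<subseteq> Z" and lr: "\<And>Z. Z \<in> \<Z> \<Longrightarrow> l Z \<inter> r Z = {}"
    using split by metis
  obtain Z\<^sub>0 where "Z\<^sub>0 \<in> \<Z>" using \<open>\<Z> \<noteq> {}\<close> by blast
  \<comment> \<open>A node of the tree lists the choices made so far, the latest one first.\<close>
  define T where "T s = foldr (\<lambda>b Z. if b then l Z else r Z) s Z\<^sub>0" for s :: "bool list"
  have T_simps: "T [] = Z\<^sub>0" "T (b # s) = (if b then l (T s) else r (T s))" for b s
    by (simp_all add: T_def)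
  have T_in: "T s \<in> \<Z>" for s
    by (induction s) (use l r \<open>Z\<^sub>0 \<in> \<Z>\<close> in \<open>auto simp: T_simps\<close>)
  have T_Cons: "T (b # s) \<subseteq> T s" for b s
    using l r T_in by (simp add: T_simps)
  have T_append: "T (u @ s) \<subseteq> T s" for u s
    by (induction u) (use T_Cons in auto)
  \<comment> \<open>Distinct nodes of the same level are disjoint: a common point lies in both
    parents, which agree by induction, and then siblings are disjoint.\<close>
  have T_inj: "s = t" if "x \<in> T s" "x \<in> T t" "length s = length t" for x s t
    using that
  proof (induction s arbitrary: t)
    case (Cons b s)
    then obtain c t' where t: "t = c # t'" by (cases t) auto
    then have "s = t'" using Cons T_Cons by (metis length_Cons nat.inject subsetD)
    moreover have "b = c"
      using Cons.prems lr[OF T_in] t \<open>s = t'\<close>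
      by (cases b; cases c) (auto simp: T_simps)
    ultimately show ?case using t by simp
  qed simp
  have T_dec: "decseq (\<lambda>n. T (replicate n b @ s))" for b s
    by (rule decseq_SucI) (simp add: T_Cons)

  \<comment> \<open>If the constant branch \<open>b\<close> above \<open>s\<close> misses
    \<open>W\<close>, it already does so at a finite stage, by the intersection property applied to
    the traces on \<open>W\<close>.\<close>
  have avoid: "\<exists>n. T (replicate n b @ s) \<inter> W = {}"
    if W: "zero_set_in X W" "(\<Inter>n. T (replicate n b @ s)) \<inter> W = {}" for b s W
  proof (rule ccontr)
    assume *: "\<not> ?thesis"
    have "(\<Inter>n. T (replicate n b @ s) \<inter> W) \<noteq> {}"
      using zero[OF T_in] W(1) * decseqD[OF T_dec[of b s]]
      by (intro pseudocompact_decseq_zero_sets[OF pc] zero_set_in_Int)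
        (auto simp: decseq_def, blast+)
    then show False using W(2) by auto
  qed

  define A where "A = (\<Union>s. \<Inter>n. T (replicate n True @ s))"
  have "A \<subseteq> topspace X"
    unfolding A_def using zero_set_in_subset[OF zero[OF T_in]] by blast
  have False_branch: "x \<notin> A" if x: "x \<in> (\<Inter>n. T (replicate n False @ s))" for x s
  proof
    assume "x \<in> A"
    then obtain t where t: "x \<in> (\<Inter>n. T (replicate n True @ t))" unfolding A_def by auto
    \<comment> \<open>The crossed lengths give both words length
      \<open>length s + length t + 1\<close>, while their heads differ, so \<open>T_inj\<close> is
      contradicted.\<close>
    have "x \<in> T (replicate (Suc (length t)) False @ s)"
      "x \<in> T (replicate (Suc (length s)) True @ t)"
      using INT_D[OF x UNIV_I] INT_D[OF t UNIV_I] by blast+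
    then have "replicate (Suc (length t)) False @ s = replicate (Suc (length s)) True @ t"
      by (rule T_inj) simp
    then show False by simp
  qed
  obtain V where V: "\<And>n::nat. zero_set_in X (V n)" "A = (\<Union>n. V n)"
    using Qf \<open>A \<subseteq> topspace X\<close> unfolding Qf_space_iff Zer_sigma_in_def by metis
  obtain W where W: "\<And>n::nat. zero_set_in X (W n)" "topspace X - A = (\<Union>n. W n)"
    using Qf unfolding Qf_space_iff Zer_sigma_in_def by (metis Diff_subset)
  \<comment> \<open>From any node, following True long enough leaves \<open>W n\<close>, as that
    branch lies in \<open>A\<close>; then following False leaves \<open>V n\<close>, as that branch
    misses \<open>A\<close>. The conjunct \<open>True\<close> is the trivial invariant in
    \<open>dependent_nat_choice\<close>.\<close>
  have step: "\<exists>t. True \<and> T t \<subseteq> T s \<and> T t \<inter> V n = {} \<and> T t \<inter> W n = {}" for s n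
  proof -
    have "(\<Inter>m. T (replicate m True @ s)) \<inter> W n = {}"
      using W(2) unfolding A_def by blast
    then obtain i where i: "T (replicate i True @ s) \<inter> W n = {}"
      using avoid W(1) by blast
    define u where "u = replicate i True @ s"
    have "(\<Inter>m. T (replicate m False @ u)) \<inter> V n = {}"
      using False_branch[of _ u] V(2) by blast
    then obtain j where j: "T (replicate j False @ u) \<inter> V n = {}"
      using avoid V(1) by blast
    have "T (replicate j False @ u) \<subseteq> T u" "T u \<subseteq> T s"
      unfolding u_def by (rule T_append)+
    then show ?thesis using i j unfolding u_def by blast
  qed
  have "\<exists>b. \<forall>n. True \<and> (T (b (Suc n)) \<subseteq> T (b n)
      \<and> T (b (Suc n)) \<inter> V n = {} \<and> T (b (Suc n)) \<inter> W n = {})"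
    by (rule dependent_nat_choice) (use step in auto)
  then obtain b where b: "\<And>n. T (b (Suc n)) \<subseteq> T (b n)"
    "\<And>n. T (b (Suc n)) \<inter> V n = {}" "\<And>n. T (b (Suc n)) \<inter> W n = {}"
    by metis
  \<comment> \<open>A point common to all these nodes avoids every \<open>V n\<close> and every
    \<open>W n\<close>, although together they cover the space.\<close>
  have "(\<Inter>n. T (b n)) \<noteq> {}"
  proof (rule pseudocompact_decseq_zero_sets[OF pc zero[OF T_in]])
    show "decseq (\<lambda>n. T (b n))" using b(1) by (rule decseq_SucI)
    show "T (b n) \<noteq> {}" for n using T_in ne by metis
  qed
  then obtain x where x: "\<And>n. x \<in> T (b n)" by blast
  then have "x \<in> topspace X" using zero_set_in_subset[OF zero[OF T_in]] by blast
  moreover have "x \<notin> (\<Union>n. V n)" "x \<notin> (\<Union>n. W n)" using b(2,3) x by blast+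
  ultimately show False using V(2) W(2) by blast
qed

text \<open>An infinite set is equinumerous with two disjoint copies of itself; the images of the
  copies are the two parts.\<close>

lemma uncountable_split:
  assumes "uncountable S"
  obtains A where "A \<subseteq> S" "uncountable A" "uncountable (S - A)"
proof -
  have "(card_of (S <+> S), card_of S) \<in> ordIso"
    using assms by (intro card_of_Plus_infinite1 card_of_mono1) (auto intro: countable_finite)
  then obtain f where f: "bij_betw f (S <+> S) S"
    using card_of_ordIso by blast
  then have inj: "inj_on f (S <+> S)" and im: "f ` (S <+> S) = S"
    by (auto simp: bij_betw_def)
  have "inj_on (\<lambda>x. f (Inl x)) S" "inj_on (\<lambda>x. f (Inr x)) S"
    using inj by (auto simp: inj_on_def)
  then have "uncountable (f ` Inl ` S)" "uncountable (f ` Inr ` S)"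
    using assms countable_image_inj_on unfolding image_image by blast+
  moreover have "f ` Inr ` S \<subseteq> S - f ` Inl ` S"
    using im inj by (auto dest: inj_onD)
  moreover have "f ` Inl ` S \<subseteq> S" using im by auto
  ultimately show ?thesis using that countable_subset by metis
qed

text \<open>A countable union of countable sets is countable, so one of the zero-sets making up
  \<open>A\<close> is uncountable.\<close>

lemma Qf_uncountable_subset:
  assumes "Qf_space X" "A \<subseteq> topspace X" "uncountable A"
  obtains Z where "zero_set_in X Z" "Z \<subseteq> A" "uncountable Z"
proof -
  obtain Z where Z: "\<And>n::nat. zero_set_in X (Z n)" "A = (\<Union>n. Z n)"
    using assms unfolding Qf_space_iff Zer_sigma_in_def by metis
  then obtain n where "uncountable (Z n)" using assms(3) by auto
  then show ?thesis using Z that by blast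
qed

lemma Qf_pseudocompact_imp_countable:
  assumes pc: "pseudocompact_space X" and Qf: "Qf_space X"
  shows "countable (topspace X)"
proof (rule ccontr)
  assume unc: "uncountable (topspace X)"
  show False
  proof (rule no_splitting_zero_sets_if_Qf[OF pc Qf, of "{Z. zero_set_in X Z \<and> uncountable Z}"])
    show "{Z. zero_set_in X Z \<and> uncountable Z} \<noteq> {}"
      using unc zero_set_in_topspace by auto
  next
    fix Z assume "Z \<in> {Z. zero_set_in X Z \<and> uncountable Z}"
    then have Z: "Z \<subseteq> topspace X" "uncountable Z" by (auto dest: zero_set_in_subset)
    obtain A where A: "A \<subseteq> Z" "uncountable A" "uncountable (Z - A)"
      using uncountable_split Z(2) .
    obtain Y where Y: "zero_set_in X Y" "Y \<subseteq> A" "uncountable Y"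
      using Qf_uncountable_subset[OF Qf _ A(2)] A(1) Z(1) by blast
    obtain Y' where Y': "zero_set_in X Y'" "Y' \<subseteq> Z - A" "uncountable Y'"
      using Qf_uncountable_subset[OF Qf _ A(3)] Z(1) by blast
    show "\<exists>Y\<in>{Z. zero_set_in X Z \<and> uncountable Z}.
        \<exists>Y'\<in>{Z. zero_set_in X Z \<and> uncountable Z}. Y \<subseteq> Z \<and> Y' \<subseteq> Z \<and> Y \<inter> Y' = {}"
      using A(1) Y Y' by (intro bexI[of _ Y] bexI[of _ Y']) auto
  qed auto
qed

section \<open>Compactness and metrizability\<close>

lemma countable_pseudocompact_imp_compact:
  assumes cr: "completely_regular_space X" and pc: "pseudocompact_space X"
    and count: "countable (topspace X)"
  shows "compact_space X"
  unfolding compact_space_alt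
proof (intro allI impI)
  fix \<U> assume \<U>: "(\<forall>U\<in>\<U>. openin X U) \<and> topspace X \<subseteq> \<Union>\<U>"
  show "\<exists>\<F>. finite \<F> \<and> \<F> \<subseteq> \<U> \<and> topspace X \<subseteq> \<Union>\<F>"
  proof (cases "topspace X = {}")
    case False
    have "\<exists>U Z. U \<in> \<U> \<and> zero_set_in X Z \<and> x \<notin> Z \<and> topspace X - U \<subseteq> Z"
      if x: "x \<in> topspace X" for x
    proof -
      obtain U where U: "U \<in> \<U>" "x \<in> U" "openin X U" using \<U> x by blast
      then obtain f :: "'a \<Rightarrow> real" where f: "continuous_map X euclideanreal f" "f x = 0"
        "f ` (topspace X - U) \<subseteq> {1}"
        using cr unfolding completely_regular_space_alt' by metis
      \<comment> \<open>The shift moves the zeros to where \<open>f\<close> is 1: it vanishes off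
        \<open>U\<close> and equals -1 at \<open>x\<close>.\<close>
      have "continuous_map X euclideanreal (\<lambda>y. f y - 1)"
        using f(1) by (intro continuous_intros) auto
      then have "zero_set_in X {y \<in> topspace X. f y - 1 = 0}"
        unfolding zero_set_in_def by blast
      then show ?thesis using U f
        by (intro exI[of _ U] exI[of _ "{y \<in> topspace X. f y - 1 = 0}"]) auto
    qed
    then obtain U Z where UZ: "\<And>x. x \<in> topspace X \<Longrightarrow> U x \<in> \<U> \<and> zero_set_in X (Z x) \<and> x \<notin> Z x
        \<and> topspace X - U x \<subseteq> Z x"
      by metis
    define p where "p = from_nat_into (topspace X)"
    have p: "p n \<in> topspace X" for n
      unfolding p_def using False by (rule from_nat_into)
    have p_surj: "range p = topspace X"
      unfolding p_def using False count by (rule range_from_nat_into)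
    \<comment> \<open>Each point is some \<open>p n\<close> and is excluded by its own
      \<open>Z (p n)\<close>. Once finitely many of these zero-sets have no common point, the
      matching \<open>U (p i)\<close> cover, since \<open>Z (p i)\<close> contains the complement of
      \<open>U (p i)\<close>.\<close>
    have "(\<Inter>n. Z (p n)) = {}"
    proof (rule equals0I)
      fix x assume x: "x \<in> (\<Inter>n. Z (p n))"
      then have "x \<in> topspace X" using UZ[OF p] zero_set_in_subset by blast
      then obtain n where "x = p n" using p_surj by blast
      then show False using x UZ[OF p[of n]] by blast
    qed
    then obtain n where n: "topspace X \<inter> (\<Inter>i\<le>n. Z (p i)) = {}"
      using pseudocompact_countable_zero_sets[OF pc, of "\<lambda>n. Z (p n)"] UZ[OF p] by blast
    have "topspace X \<subseteq> \<Union> ((\<lambda>i. U (p i)) ` {..n})"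
      using n UZ[OF p] by blast
    then show ?thesis
      using UZ[OF p] by (intro exI[of _ "(\<lambda>i. U (p i)) ` {..n}"]) auto
  qed auto
qed

lemma Qf_singleton_zero_set:
  assumes "Qf_space X" "x \<in> topspace X"
  shows "zero_set_in X {x}"
proof -
  obtain Z where Z: "\<And>n::nat. zero_set_in X (Z n)" "{x} = (\<Union>n. Z n)"
    using assms unfolding Qf_space_iff Zer_sigma_in_def by (metis empty_subsetI insert_subset)
  then obtain n where "Z n = {x}" by blast
  then show ?thesis using Z(1) by metis
qed

text \<open>The functions vanishing at exactly one point are the coordinates of a continuous
  injection into a countable power of the line; from a compact space into a Hausdorff one this is an
  embedding.\<close>

lemma countable_compact_zero_set_points_imp_metrizable:
  assumes comp: "compact_space X" and count: "countable (topspace X)"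
    and pts: "\<And>x. x \<in> topspace X \<Longrightarrow> zero_set_in X {x}"
  shows "metrizable_space X"
proof -
  obtain f :: "'a \<Rightarrow> 'a \<Rightarrow> real" where
    f: "\<And>x. x \<in> topspace X \<Longrightarrow> continuous_map X euclideanreal (f x)"
       "\<And>x. x \<in> topspace X \<Longrightarrow> {x} = {y \<in> topspace X. f x y = 0}"
    using pts unfolding zero_set_in_def by metis
  let ?P = "product_topology (\<lambda>_. euclideanreal) (topspace X)"
  let ?e = "\<lambda>y. restrict (\<lambda>x. f x y) (topspace X)"
  have "continuous_map X ?P ?e"
    using f(1) by (auto simp: continuous_map_componentwise)
  moreover have "inj_on ?e (topspace X)"
  proof (rule inj_onI)
    fix x y assume xy: "x \<in> topspace X" "y \<in> topspace X" and eq: "?e x = ?e y"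
    \<comment> \<open>Coordinate \<open>x\<close> alone separates \<open>x\<close> from every other
      point.\<close>
    have "f x x = f x y" using arg_cong[where f = "\<lambda>g. g x", OF eq] xy by simp
    moreover have "x \<in> {y \<in> topspace X. f x y = 0}"
      using f(2)[OF xy(1)] by (rule subst) simp
    ultimately have "y \<in> {y \<in> topspace X. f x y = 0}" using xy by simp
    then show "x = y" unfolding f(2)[OF xy(1), symmetric] by simp
  qed
  moreover have "Hausdorff_space ?P"
    by (simp add: Hausdorff_space_product_topology)
  ultimately have "X homeomorphic_space subtopology ?P (?e ` topspace X)"
    using comp by (intro embedding_map_imp_homeomorphic_space continuous_imp_embedding_map)
  moreover have "metrizable_space ?P"
    using count unfolding metrizable_space_product_topology
    by (auto simp: metrizable_space_euclidean)
  ultimately show ?thesis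
    using homeomorphic_metrizable_space metrizable_space_subtopology by blast
qed

lemma metrizable_singleton_zero_set:
  assumes "metrizable_space X" "x \<in> topspace X"
  shows "zero_set_in X {x}"
proof -
  obtain M d where "Metric_space M d" and X: "X = Metric_space.mtopology M d"
    using assms(1) by (auto simp: metrizable_space_def)
  then interpret Metric_space M d by simp
  have "x \<in> M" using assms(2) X by simp
  then have "continuous_map X euclideanreal (\<lambda>y. d x y)"
    unfolding X using continuous_on_mdist[of x "metric (M, d)"] by simp
  moreover have "{x} = {y \<in> topspace X. d x y = 0}"
    using \<open>x \<in> M\<close> X by auto
  ultimately show ?thesis unfolding zero_set_in_def by blast
qed

text \<open>Every subset is a countable union of singletons, each the zero-set of a distance
  function. The empty set is separate because \<open>from_nat_into\<close> enumerates only nonempty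
  sets.\<close>

lemma countable_metrizable_imp_Qf:
  assumes "countable (topspace X)" "metrizable_space X"
  shows "Qf_space X"
  unfolding Qf_space_iff
proof (intro allI impI)
  fix A assume A: "A \<subseteq> topspace X"
  show "Zer_sigma_in X A"
  proof (cases "A = {}")
    case True
    then show ?thesis
      unfolding Zer_sigma_in_def by (intro exI[of _ "\<lambda>_. {}"]) (auto simp: zero_set_in_empty)
  next
    case False
    then have "range (from_nat_into A) = A"
      using A assms(1) by (meson countable_subset range_from_nat_into)
    then show ?thesis
      unfolding Zer_sigma_in_def using A False
      by (intro exI[of _ "\<lambda>n. {from_nat_into A n}"])
         (auto intro!: metrizable_singleton_zero_set[OF assms(2)] dest: from_nat_into)
  qed
qed

theorem proposition2p20:
  fixes X :: "'a topology"
  assumes "tychonoff_space X" and "pseudocompact_space X"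
  shows "Qf_space X \<longleftrightarrow> countable (topspace X) \<and> metrizable_space X \<and> compact_space X"
proof
  assume Qf: "Qf_space X"
  have count: "countable (topspace X)"
    using Qf_pseudocompact_imp_countable assms(2) Qf by blast
  moreover have "compact_space X"
    using countable_pseudocompact_imp_compact assms count unfolding tychonoff_space_def by blast
  ultimately show "countable (topspace X) \<and> metrizable_space X \<and> compact_space X"
    using countable_compact_zero_set_points_imp_metrizable Qf_singleton_zero_set[OF Qf] by blast
next
  assume "countable (topspace X) \<and> metrizable_space X \<and> compact_space X"
  then show "Qf_space X" by (simp add: countable_metrizable_imp_Qf)
qed

end
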